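(* Let $L$ be a Lie superalgebra over a field of characteristic zero, and let $P\colon L\to L$ be an even (parity-preserving) linear map with $P^2=P$ such that for all $a,b\in L$ $$[Pa,Pb]=0\qquad\text{and}\qquad P[a,b]=P[Pa,b]+P[a,Pb].$$ Let $V=P(L)$, let $\Delta\in L$ be an odd element, and put $\Delta^2:=\tfrac12[\Delta,\Delta]$. Let $r\geq 0$ be an integer such that $\operatorname{ord}_V\Delta^2\leq r$. Then the derived brackets of $\Delta$, $$\{a_1,\ldots,a_n\}_\Delta:=P[\ldots[[\Delta,a_1],a_2],\ldots,a_n],\qquad a_i\in V,\ n=0,1,2,\ldots,$$ (for $n=0$: $\{\varnothing\}_\Delta:=P(\Delta)$) satisfy the generalized Jacobi identities of all orders $n>r$.
   Context: All vector spaces are $\mathbb{Z}_2$-graded; $\tilde a\in\mathbb Z_2$ denotes the parity of a homogeneous element $a$. Formulas with signs are stated for homogeneous elements and extended by multilinearity. Order: for $E\in L$ and a subalgebra $V\subset L$, $\operatorname{ord}_V E\leq r$ means that all $(r+1)$-fold commutators $[\ldots[[E,a_1],a_2],\ldots,a_{r+1}]$ with arbitrary $a_1,\ldots,a_{r+1}\in V$ vanish. Generalized Jacobi identities: for a sequence of odd $n$-linear operations $\{\cdot,\ldots,\cdot\}$, $n=0,1,2,\ldots$, on $V$, symmetric in the $\mathbb Z_2$-graded sense (as the derived brackets of an odd element are), the generalized Jacobi identity of order $n$ is $$\sum_{k+l=n}\ \sum_{(k,l)\text{-shuffles }\sigma}(-1)^{\alpha}\,\{\{a_{\sigma(1)},\ldots,a_{\sigma(k)}\},a_{\sigma(k+1)},\ldots,a_{\sigma(k+l)}\}=0\quad\text{for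 all }a_1,\ldots,a_n\in V,$$ with $k,l\ge0$, where a $(k,l)$-shuffle is a permutation $\sigma$ of $1,\ldots,k+l$ with $\sigma(1)<\dots<\sigma(k)$ and $\sigma(k+1)<\dots<\sigma(k+l)$. The sign $(-1)^\alpha$ is the Koszul sign of the permutation $(a_1,\ldots,a_n)\mapsto(a_{\sigma(1)},\ldots,a_{\sigma(n)})$: a factor $(-1)^{\tilde a\tilde b}$ for every transposition of adjacent elements $a,b$, and no other signs. For $k=0$ the inner bracket is the $0$-ary bracket $\{\varnothing\}$. *)

theory Defs
  imports Complex_Main "HOL-Library.Z2" "HOL-Combinatorics.Permutations"
begin

text \<open>Parities are elements of the field \<open>bit\<close> with two elements; \<open>parity_sign x y\<close> is
  \<open>(-1)\<close> to the power \<open>x * y\<close>.\<close>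

definition parity_sign :: "bit \<Rightarrow> bit \<Rightarrow> 'k::comm_ring_1"
  where "parity_sign x y = (if x = 1 \<and> y = 1 then - 1 else 1)"

text \<open>The Lie superalgebra is the whole type \<open>'v\<close>; \<open>grade 0\<close> and \<open>grade 1\<close> are its even and
  odd parts.  In characteristic zero no further axioms on squares or cubes are needed.\<close>

locale lie_superalgebra = vector_space scale
  for scale :: "'k::field_char_0 \<Rightarrow> 'v::ab_group_add \<Rightarrow> 'v" +
  fixes grade :: "bit \<Rightarrow> 'v set"
    and bracket :: "'v \<Rightarrow> 'v \<Rightarrow> 'v"
  assumes subspace_grade: "subspace (grade i)"
    and grade_Int: "grade 0 \<inter> grade 1 = {0}"
    and grade_decomp: "\<exists>x\<in>grade 0. \<exists>y\<in>grade 1. v = x + y"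
    and linear_bracket_left: "Vector_Spaces.linear scale scale (\<lambda>x. bracket x y)"
    and linear_bracket_right: "Vector_Spaces.linear scale scale (\<lambda>y. bracket x y)"
    and bracket_grade: "\<lbrakk>x \<in> grade i; y \<in> grade j\<rbrakk> \<Longrightarrow> bracket x y \<in> grade (i + j)"
    and super_antisym: "\<lbrakk>x \<in> grade i; y \<in> grade j\<rbrakk> \<Longrightarrow>
      bracket x y = - scale (parity_sign i j) (bracket y x)"
    and super_jacobi: "\<lbrakk>x \<in> grade i; y \<in> grade j; z \<in> grade l\<rbrakk> \<Longrightarrow>
      bracket x (bracket y z) =
        bracket (bracket x y) z + scale (parity_sign i j) (bracket y (bracket x z))"

text \<open>\<open>iterated_bracket bracket E [a\<^sub>1, \<dots>, a\<^sub>n]\<close> is \<open>[\<dots>[[E, a\<^sub>1], a\<^sub>2], \<dots>, a\<^sub>n]\<close>.\<close>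

definition iterated_bracket :: "('v \<Rightarrow> 'v \<Rightarrow> 'v) \<Rightarrow> 'v \<Rightarrow> 'v list \<Rightarrow> 'v"
  where "iterated_bracket bracket E as = foldl bracket E as"

definition ord_le :: "('v::zero \<Rightarrow> 'v \<Rightarrow> 'v) \<Rightarrow> 'v set \<Rightarrow> 'v \<Rightarrow> nat \<Rightarrow> bool"
  where "ord_le bracket V E r \<longleftrightarrow>
    (\<forall>as. length as = r + 1 \<and> set as \<subseteq> V \<longrightarrow> iterated_bracket bracket E as = 0)"

definition derived_bracket ::
    "('v \<Rightarrow> 'v \<Rightarrow> 'v) \<Rightarrow> ('v \<Rightarrow> 'v) \<Rightarrow> 'v \<Rightarrow> 'v list \<Rightarrow> 'v"
  where "derived_bracket bracket P D as = P (iterated_bracket bracket D as)"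

definition kl_shuffles :: "nat \<Rightarrow> nat \<Rightarrow> (nat \<Rightarrow> nat) set"
  where "kl_shuffles k l = {\<sigma>. \<sigma> permutes {1..k + l} \<and>
    strict_mono_on {1..k} \<sigma> \<and> strict_mono_on {k + 1..k + l} \<sigma>}"

text \<open>The sign of \<open>(a\<^sub>1, \<dots>, a\<^sub>n) \<mapsto> (a (\<sigma> 1), \<dots>, a (\<sigma> n))\<close>, where \<open>a i\<close> has parity \<open>p i\<close>.
  The two lemmas below show that the product over inversions is the sign obtained by
  decomposing \<open>\<sigma>\<close> into transpositions of adjacent elements.\<close>

definition koszul_sign :: "(nat \<Rightarrow> bit) \<Rightarrow> nat \<Rightarrow> (nat \<Rightarrow> nat) \<Rightarrow> 'k::comm_ring_1"
  where "koszul_sign p n \<sigma> =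
    (\<Prod>(i, j)\<in>{(i, j). 1 \<le> i \<and> i < j \<and> j \<le> n \<and> \<sigma> j < \<sigma> i}. parity_sign (p (\<sigma> i)) (p (\<sigma> j)))"

lemma koszul_sign_id: "koszul_sign p n id = 1"
proof -
  have "{(i, j). 1 \<le> i \<and> i < j \<and> j \<le> n \<and> id j < id i} = {}"
    by auto
  then show ?thesis
    unfolding koszul_sign_def by (metis (no_types, lifting) prod.empty)
qed

lemma koszul_sign_adjacent_transposition:
  assumes "\<sigma> permutes {1..n}" and "1 \<le> m" and "m < n"
  shows "koszul_sign p n (\<sigma> \<circ> transpose m (m + 1)) =
    parity_sign (p (\<sigma> m)) (p (\<sigma> (m + 1))) * (koszul_sign p n \<sigma> :: 'k::comm_ring_1)"
proof -
  define Q where "Q = {(i, j). 1 \<le> i \<and> i < j \<and> j \<le> n}"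
  define f where "f \<rho> = (\<lambda>(i, j). if \<rho> j < \<rho> i then parity_sign (p (\<rho> i)) (p (\<rho> j)) else (1::'k))"
    for \<rho> :: "nat \<Rightarrow> nat"
  let ?t = "transpose m (m + 1)"
  let ?e = "(m, m + 1)"
  have fin: "finite Q"
    by (rule finite_subset[of _ "{1..n} \<times> {1..n}"]) (auto simp: Q_def)
  have eQ: "?e \<in> Q"
    using assms by (simp add: Q_def)
  have split: "koszul_sign p n \<rho> = f \<rho> ?e * prod (f \<rho>) (Q - {?e})" for \<rho>
  proof -
    have "koszul_sign p n \<rho> = prod (f \<rho>) Q"
      unfolding koszul_sign_def
      by (rule prod.mono_neutral_cong_left[OF fin]) (auto simp: Q_def f_def split: if_splits)
    then show ?thesis
      using prod.remove[OF fin eQ] by simp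
  qed
  have closed: "map_prod ?t ?t x \<in> Q - {?e}" if "x \<in> Q - {?e}" for x
    using that assms by (auto simp: Q_def transpose_def split: if_splits)
  have "prod (f (\<sigma> \<circ> ?t)) (Q - {?e}) = prod (f \<sigma>) (Q - {?e})"
    by (rule prod.reindex_bij_witness[of _ "map_prod ?t ?t" "map_prod ?t ?t"])
      (use closed in \<open>auto simp: f_def o_def\<close>)
  moreover have "\<sigma> m \<noteq> \<sigma> (m + 1)"
    using permutes_inj[OF assms(1)] by (metis add_cancel_right_right injD one_neq_zero)
  then have "f (\<sigma> \<circ> ?t) ?e = parity_sign (p (\<sigma> m)) (p (\<sigma> (m + 1))) * f \<sigma> ?e"
    by (auto simp: f_def parity_sign_def)
  ultimately show ?thesis
    by (simp add: split mult.assoc)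
qed

text \<open>The generalized Jacobi identity of order \<open>n\<close> for a family of brackets on \<open>V\<close>
  (lists carry the arguments, so \<open>br []\<close> is the \<open>0\<close>-ary bracket).  As the signs involve
  parities, the arguments are arbitrary homogeneous elements of \<open>V\<close>.\<close>

definition generalized_jacobi ::
    "('k::field_char_0 \<Rightarrow> 'v::ab_group_add \<Rightarrow> 'v) \<Rightarrow> (bit \<Rightarrow> 'v set) \<Rightarrow> 'v set \<Rightarrow>
      ('v list \<Rightarrow> 'v) \<Rightarrow> nat \<Rightarrow> bool"
  where "generalized_jacobi scale grade V br n \<longleftrightarrow>
    (\<forall>a p. (\<forall>i\<in>{1..n}. a i \<in> V \<inter> grade (p i)) \<longrightarrow>
      (\<Sum>(k, l)\<in>{(k, l). k + l = n}. \<Sum>\<sigma>\<in>kl_shuffles k l.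
        scale (koszul_sign p n \<sigma>)
          (br (br (map (\<lambda>i. a (\<sigma> i)) [1..<k + 1]) #
               map (\<lambda>i. a (\<sigma> i)) [k + 1..<k + l + 1]))) = 0)"

end

theory Submission
  imports Defs
begin

text \<open>
  The left-hand side of the \<open>n\<close>-th generalized Jacobi identity, the Jacobiator, equals the
  \<open>n\<close>-ary derived bracket of \<open>\<Delta>\<^sup>2 = [\<Delta>, \<Delta>] / 2\<close>
  (\<open>jacobiator_eq_derived_bracket_square\<close>).  The latter is \<open>P\<close> of an \<open>n\<close>-fold commutator of
  \<open>\<Delta>\<^sup>2\<close> with elements of \<open>V\<close>, hence zero as soon as \<open>n\<close> exceeds the order of \<open>\<Delta>\<^sup>2\<close>.

  For the equality, a \<open>(k, l)\<close>-shuffle with \<open>k + l = n\<close> is the same thing as the set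
  \<open>S = {\<sigma> 1, \<dots>, \<sigma> k}\<close>, its complement \<open>T\<close> giving the remaining arguments
  (\<open>sum_kl_shuffles_eq_sum_Pow\<close>); let \<open>\<epsilon>(S, T)\<close> be its Koszul sign.  Write \<open>\<Delta>\<^sub>S\<close> for the iterated
  commutator of \<open>\<Delta>\<close> with the \<open>a\<^sub>i\<close>, \<open>i \<in> S\<close>, in increasing order, and \<open>|S|\<close> for the sum of their
  parities, so that \<open>\<Delta>\<^sub>S\<close> has parity \<open>1 + |S|\<close>.  Three computations meet:

  \<^item> As \<open>V\<close> is abelian, commutators with elements of \<open>V\<close> may be interchanged up to sign
    (\<open>iter_Cons_commute\<close>).  Moving the argument \<open>P \<Delta>\<^sub>S\<close> of the outer bracket to the last place
    shows that the Jacobiator is \<open>J = \<Sum>\<^sub>S \<epsilon>(S, T) (-1)\<^bsup>(1 + |S|)|T|\<^esup> P [\<Delta>\<^sub>T, P \<Delta>\<^sub>S]\<close>.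

  \<^item> Since commutators from the right are graded derivations, the \<open>n\<close>-fold commutator of
    \<open>[\<Delta>, \<Delta>]\<close> is \<open>\<Sum>\<^sub>S \<epsilon>(S, T) (-1)\<^bsup>|S|\<^esup> [\<Delta>\<^sub>S, \<Delta>\<^sub>T]\<close>
    (\<open>iter_bracket_expand\<close>); the extra sign comes from moving the \<open>a\<^sub>i\<close> with \<open>i \<in> S\<close> past the
    second \<open>\<Delta>\<close>.

  \<^item> The identity for \<open>P\<close> splits \<open>P [\<Delta>\<^sub>S, \<Delta>\<^sub>T]\<close> into \<open>P [P \<Delta>\<^sub>S, \<Delta>\<^sub>T]\<close> and
    \<open>P [\<Delta>\<^sub>S, P \<Delta>\<^sub>T]\<close>.  By graded antisymmetry the first summands add up to \<open>J\<close>.  So do the second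
    ones, after exchanging the roles of \<open>S\<close> and \<open>T\<close>.

  Thus the \<open>n\<close>-ary derived bracket of \<open>[\<Delta>, \<Delta>]\<close> is \<open>2 J\<close>.
\<close>

section \<open>Shuffles as subsets\<close>

text \<open>The Koszul sign of rearranging \<open>S \<union> T\<close> so that \<open>S\<close> comes before \<open>T\<close>, each in increasing
  order: only pairs with \<open>t < s\<close> change their order.\<close>

definition unshuffle_sign :: "(nat \<Rightarrow> bit) \<Rightarrow> nat set \<Rightarrow> nat set \<Rightarrow> 'k::comm_ring_1"
  where "unshuffle_sign p S T = (\<Prod>(s, t)\<in>{(s, t). s \<in> S \<and> t \<in> T \<and> t < s}. parity_sign (p s) (p t))"

text \<open>The inverse of \<open>\<sigma> \<mapsto> \<sigma> ` {1..k}\<close>.  Outside \<open>{1..n}\<close> it is the identity, as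
  \<open>permutes\<close> demands.\<close>

definition shuffle_of :: "nat \<Rightarrow> nat set \<Rightarrow> nat \<Rightarrow> nat"
  where "shuffle_of n S i = (if i \<in> {1..n}
    then (sorted_list_of_set S @ sorted_list_of_set ({1..n} - S)) ! (i - 1) else i)"

lemma finite_kl_shuffles: "finite (kl_shuffles k l)"
  by (rule finite_subset[OF _ finite_permutations[of "{1..k + l}"]]) (auto simp: kl_shuffles_def)

lemma map_strict_mono_upt:
  fixes \<sigma> :: "nat \<Rightarrow> nat"
  assumes "strict_mono_on {a..<b} \<sigma>"
  shows "map \<sigma> [a..<b] = sorted_list_of_set (\<sigma> ` {a..<b})"
proof -
  have "sorted_wrt (<) (map \<sigma> [a..<b])"
    unfolding sorted_wrt_map
    by (rule sorted_wrt_mono_rel[OF _ sorted_wrt_upt]) (use strict_mono_onD[OF assms] in auto)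
  then have "sorted_list_of_set (set (map \<sigma> [a..<b])) = map \<sigma> [a..<b]"
    by (metis sorted_list_of_set.idem_if_sorted_distinct strict_sorted_iff)
  then show ?thesis by simp
qed

text \<open>Being increasing on each block, a shuffle lists the image of its first block, and then the
  complement of that image, in increasing order; so the image determines the shuffle.\<close>

lemma kl_shuffle_blocks:
  assumes "\<sigma> \<in> kl_shuffles k l"
  shows "map \<sigma> [1..<k + 1] = sorted_list_of_set (\<sigma> ` {1..k})"
    and "map \<sigma> [k + 1..<k + l + 1] = sorted_list_of_set ({1..k + l} - \<sigma> ` {1..k})"
    and "\<sigma> ` {1..k} \<subseteq> {1..k + l}"
    and "card (\<sigma> ` {1..k}) = k"
proof -
  have perm: "\<sigma> permutes {1..k + l}"
    and m1: "strict_mono_on {1..k} \<sigma>" and m2: "strict_mono_on {k + 1..k + l} \<sigma>"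
    using assms by (auto simp: kl_shuffles_def)
  have inj: "inj \<sigma>" using permutes_inj[OF perm] .
  have e: "{a..<b + 1} = {a..b}" for a b :: nat by auto
  show "map \<sigma> [1..<k + 1] = sorted_list_of_set (\<sigma> ` {1..k})"
    using map_strict_mono_upt[of 1 "k + 1" \<sigma>] m1 unfolding e by blast
  have "{k + 1..k + l} = {1..k + l} - {1..k}" by auto
  then have "\<sigma> ` {k + 1..k + l} = {1..k + l} - \<sigma> ` {1..k}"
    using image_set_diff[OF inj] permutes_image[OF perm] by metis
  then show "map \<sigma> [k + 1..<k + l + 1] = sorted_list_of_set ({1..k + l} - \<sigma> ` {1..k})"
    using map_strict_mono_upt[of "k + 1" "k + l + 1" \<sigma>] m2 unfolding e by simp
  have "\<sigma> ` {1..k} \<subseteq> \<sigma> ` {1..k + l}" by (intro image_mono) auto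
  then show "\<sigma> ` {1..k} \<subseteq> {1..k + l}"
    using permutes_image[OF perm] by simp
  show "card (\<sigma> ` {1..k}) = k"
    using card_image[OF inj_on_subset[OF inj subset_UNIV]] by simp
qed

lemma shuffle_of_image_block:
  assumes "\<sigma> \<in> kl_shuffles k l"
  shows "shuffle_of (k + l) (\<sigma> ` {1..k}) = \<sigma>"
proof
  fix i
  have perm: "\<sigma> permutes {1..k + l}" using assms by (auto simp: kl_shuffles_def)
  have "map \<sigma> [1..<k + l + 1] = map \<sigma> [1..<k + 1] @ map \<sigma> [k + 1..<k + l + 1]"
    using upt_add_eq_append[of 1 "k + 1" l] by (simp add: add.commute add.left_commute)
  then have "map \<sigma> [1..<k + l + 1] = sorted_list_of_set (\<sigma> ` {1..k}) @
      sorted_list_of_set ({1..k + l} - \<sigma> ` {1..k})"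
    using kl_shuffle_blocks[OF assms] by metis
  moreover have "map \<sigma> [1..<k + l + 1] ! (i - 1) = \<sigma> i" if "i \<in> {1..k + l}"
    using that by (subst nth_map) (auto simp del: upt_Suc)
  ultimately show "shuffle_of (k + l) (\<sigma> ` {1..k}) i = \<sigma> i"
    using permutes_not_in[OF perm] by (auto simp: shuffle_of_def)
qed

lemma
  assumes S: "S \<subseteq> {1..n}"
  shows shuffle_of_in_kl_shuffles: "shuffle_of n S \<in> kl_shuffles (card S) (n - card S)"
    and image_shuffle_of: "shuffle_of n S ` {1..card S} = S"
proof -
  let ?S = "sorted_list_of_set S" and ?T = "sorted_list_of_set ({1..n} - S)"
  have fin: "finite S" using S finite_subset by blast
  have le: "card S \<le> n" using card_mono[OF _ S] by simp
  have lT: "length ?T = n - card S" using S fin by (simp add: card_Diff_subset)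
  have lS: "length ?S = card S" by simp
  have first: "shuffle_of n S i = ?S ! (i - 1)" if "i \<in> {1..card S}" for i
    using that le by (auto simp: shuffle_of_def nth_append)
  have second: "shuffle_of n S i = ?T ! (i - 1 - card S)" if "i \<in> {card S + 1..n}" for i
    using that by (auto simp: shuffle_of_def nth_append)
  have stS: "sorted_wrt (<) ?S" and stT: "sorted_wrt (<) ?T" by simp_all
  have m1: "strict_mono_on {1..card S} (shuffle_of n S)"
  proof (rule strict_mono_onI)
    fix i j assume "i \<in> {1..card S}" "j \<in> {1..card S}" "i < j"
    then show "shuffle_of n S i < shuffle_of n S j"
      unfolding first[OF \<open>i \<in> _\<close>] first[OF \<open>j \<in> _\<close>]
      by (intro sorted_wrt_nth_less[OF stS]) auto
  qed
  have m2: "strict_mono_on {card S + 1..n} (shuffle_of n S)"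
  proof (rule strict_mono_onI)
    fix i j assume "i \<in> {card S + 1..n}" "j \<in> {card S + 1..n}" "i < j"
    then show "shuffle_of n S i < shuffle_of n S j"
      unfolding second[OF \<open>i \<in> _\<close>] second[OF \<open>j \<in> _\<close>]
      by (intro sorted_wrt_nth_less[OF stT]) (auto simp only: lT atLeastAtMost_iff)
  qed
  let ?L = "?S @ ?T"
  have lL: "length ?L = n" using le lT by simp
  have dL: "distinct ?L" using fin by auto
  have sL: "set ?L = {1..n}" using S fin by auto
  have "bij_betw (\<lambda>i. ?L ! (i - 1)) {1..n} {1..n}"
  proof -
    have "bij_betw (\<lambda>i. i - 1) {1..n} {..<n}"
      by (rule bij_betw_byWitness[where f' = Suc]) auto
    moreover have "bij_betw ((!) ?L) {..<n} {1..n}"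
      using dL by (rule bij_betw_nth) (simp_all only: lL sL)
    ultimately show ?thesis
      using bij_betw_trans by (fastforce simp only: comp_def)
  qed
  then have "bij_betw (shuffle_of n S) {1..n} {1..n}"
    by (subst bij_betw_cong[where g = "\<lambda>i. ?L ! (i - 1)"]) (auto simp: shuffle_of_def)
  then have "shuffle_of n S permutes {1..n}"
    by (rule bij_imp_permutes) (auto simp: shuffle_of_def)
  with m1 m2 le show "shuffle_of n S \<in> kl_shuffles (card S) (n - card S)"
    by (simp add: kl_shuffles_def)
  have "shuffle_of n S ` {1..card S} = (\<lambda>i. ?S ! (i - 1)) ` {1..card S}"
    using first by (intro image_cong) auto
  also have "\<dots> = (\<lambda>i. ?S ! i) ` (\<lambda>i. i - 1) ` {1..card S}" by (simp add: image_image)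
  also have "(\<lambda>i. i - 1) ` {1..card S} = {..<length ?S}"
    by (auto simp: image_iff intro!: bexI[of _ "Suc _"])
  also have "(\<lambda>i. ?S ! i) ` {..<length ?S} = set ?S"
    by (auto simp: set_conv_nth)
  finally show "shuffle_of n S ` {1..card S} = S" using fin by simp
qed

text \<open>A shuffle has no inversions inside a block, so its inversions are the pairs
  \<open>(s, t)\<close> with \<open>s\<close> in the image of the first block, \<open>t\<close> outside it and \<open>t < s\<close>.\<close>

lemma koszul_sign_kl_shuffle:
  assumes "\<sigma> \<in> kl_shuffles k l"
  shows "koszul_sign p (k + l) \<sigma> =
    (unshuffle_sign p (\<sigma> ` {1..k}) ({1..k + l} - \<sigma> ` {1..k}) :: 'k::comm_ring_1)"
proof -
  have perm: "\<sigma> permutes {1..k + l}"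
    and m1: "strict_mono_on {1..k} \<sigma>" and m2: "strict_mono_on {k + 1..k + l} \<sigma>"
    using assms by (auto simp: kl_shuffles_def)
  have inj: "inj \<sigma>" using permutes_inj[OF perm] .
  let ?I = "{(i, j). 1 \<le> i \<and> i < j \<and> j \<le> k + l \<and> \<sigma> j < \<sigma> i}"
  let ?A = "{(s, t). s \<in> \<sigma> ` {1..k} \<and> t \<in> {1..k + l} - \<sigma> ` {1..k} \<and> t < s}"
  have straddle: "i \<le> k \<and> k < j" if "(i, j) \<in> ?I" for i j
  proof -
    have "\<not> j \<le> k" using that strict_mono_onD[OF m1, of i j] by force
    moreover have "\<not> k < i" using that strict_mono_onD[OF m2, of i j] by force
    ultimately show ?thesis by simp
  qed
  have img: "\<sigma> j \<in> {1..k + l} \<longleftrightarrow> j \<in> {1..k + l}" for j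
    using permutes_in_image[OF perm] .
  have "map_prod \<sigma> \<sigma> ` ?I = ?A"
  proof (intro set_eqI iffI)
    fix x assume "x \<in> map_prod \<sigma> \<sigma> ` ?I"
    then obtain i j where ij: "(i, j) \<in> ?I" and x: "x = (\<sigma> i, \<sigma> j)" by auto
    have "\<sigma> j \<notin> \<sigma> ` {1..k}" using straddle[OF ij] inj by (auto simp: inj_image_mem_iff)
    then show "x \<in> ?A" using x ij straddle[OF ij] img[of j] by auto
  next
    fix x assume "x \<in> ?A"
    then obtain i t where i: "i \<in> {1..k}" and x: "x = (\<sigma> i, t)"
      and t: "t \<in> {1..k + l}" "t \<notin> \<sigma> ` {1..k}" "t < \<sigma> i" by auto
    obtain j where j: "t = \<sigma> j" "j \<in> {1..k + l}"
      using t(1) permutes_image[OF perm] by (metis imageE)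
    with t have "j \<notin> {1..k}" by auto
    with i j t have "(i, j) \<in> ?I" by auto
    then show "x \<in> map_prod \<sigma> \<sigma> ` ?I" using x j by force
  qed
  moreover have "inj_on (map_prod \<sigma> \<sigma>) ?I"
    using inj by (auto simp: inj_on_def)
  ultimately have "(unshuffle_sign p (\<sigma> ` {1..k}) ({1..k + l} - \<sigma> ` {1..k}) :: 'k) =
      prod ((\<lambda>(s, t). parity_sign (p s) (p t)) \<circ> map_prod \<sigma> \<sigma>) ?I"
    unfolding unshuffle_sign_def by (metis (no_types, lifting) prod.reindex)
  then show ?thesis
    by (simp add: koszul_sign_def comp_def case_prod_unfold)
qed

text \<open>The form in which shuffles enter the later computations: subsets of \<open>{1..n}\<close>, unlike
  shuffles, behave well under induction on \<open>n\<close> and under taking complements.\<close>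

lemma sum_kl_shuffles_eq_sum_Pow:
  fixes f :: "'k::comm_ring_1 \<Rightarrow> nat list \<Rightarrow> nat list \<Rightarrow> 'a::comm_monoid_add"
  shows "(\<Sum>(k, l)\<in>{(k, l). k + l = n}. \<Sum>\<sigma>\<in>kl_shuffles k l.
      f (koszul_sign p n \<sigma>) (map \<sigma> [1..<k + 1]) (map \<sigma> [k + 1..<k + l + 1])) =
    (\<Sum>S\<in>Pow {1..n}. f (unshuffle_sign p S ({1..n} - S))
      (sorted_list_of_set S) (sorted_list_of_set ({1..n} - S)))"
    (is "?lhs = ?rhs")
proof -
  let ?K = "{(k, l). k + l = n}"
  have finK: "finite ?K"
    by (rule finite_subset[of _ "{0..n} \<times> {0..n}"]) auto
  have "?lhs = (\<Sum>((k, l), \<sigma>)\<in>(SIGMA (k, l):?K. kl_shuffles k l).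
      f (koszul_sign p n \<sigma>) (map \<sigma> [1..<k + 1]) (map \<sigma> [k + 1..<k + l + 1]))"
    using finK finite_kl_shuffles by (subst sum.Sigma[symmetric]) (auto simp: case_prod_unfold simp del: upt_Suc)
  also have "\<dots> = ?rhs"
  proof (rule sum.reindex_bij_witness[where
        i = "\<lambda>S. ((card S, n - card S), shuffle_of n S)"
        and j = "\<lambda>((k, l), \<sigma>). \<sigma> ` {1..k}"], goal_cases)
    case (1 x)
    then show ?case using shuffle_of_image_block kl_shuffle_blocks(4) by auto
  next
    case (2 x)
    then show ?case using kl_shuffle_blocks(3) by fastforce
  next
    case (3 S)
    then show ?case using image_shuffle_of by auto
  next
    case (4 S)
    then have "card S \<le> n" using card_mono[of "{1..n}" S] by simp
    with 4 show ?case using shuffle_of_in_kl_shuffles by auto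
  next
    case (5 x)
    then obtain k l \<sigma> where x: "x = ((k, l), \<sigma>)" "n = k + l" "\<sigma> \<in> kl_shuffles k l" by auto
    show ?case
      unfolding x(1,2) prod.case koszul_sign_kl_shuffle[OF x(3)] kl_shuffle_blocks(1,2)[OF x(3)] ..
  qed
  finally show ?thesis .
qed

section \<open>Signs\<close>

lemma bit_cases: "b = 0 \<or> b = (1::bit)"
  by (cases b) auto

lemma parity_sign_add_left: "parity_sign (x + y) z = parity_sign x z * parity_sign y z"
  using bit_cases[of x] bit_cases[of y] by (auto simp: parity_sign_def)

lemma parity_sign_commute: "parity_sign x y = parity_sign y x"
  by (simp add: parity_sign_def conj_commute)

lemma parity_sign_add_right: "parity_sign x (y + z) = parity_sign x y * parity_sign x z"
  using parity_sign_add_left by (metis parity_sign_commute)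

lemma parity_sign_sum_right:
  "parity_sign x (\<Sum>i\<in>A. p i) = (\<Prod>i\<in>A. parity_sign x (p i))"
proof (induction A rule: infinite_finite_induct)
  case (insert a A)
  have "parity_sign x (b + c) = parity_sign x b * (parity_sign x c :: 'a)" for b c
    using bit_cases[of b] bit_cases[of c] by (auto simp: parity_sign_def)
  with insert show ?case by simp
qed (auto simp: parity_sign_def)

lemma parity_sign_sum_left:
  "parity_sign (\<Sum>i\<in>A. p i) x = (\<Prod>i\<in>A. parity_sign (p i) x)"
  using parity_sign_sum_right[of x p A] by (simp add: parity_sign_def conj_commute)

text \<open>The two signs together count every pair in \<open>S \<times> T\<close> exactly once: a pair is out of order
  either for \<open>S\<close> before \<open>T\<close> or for \<open>T\<close> before \<open>S\<close>.\<close>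

lemma unshuffle_sign_swap:
  assumes "finite S" "finite T" "S \<inter> T = {}"
  shows "unshuffle_sign p S T =
    parity_sign (\<Sum>i\<in>S. p i) (\<Sum>i\<in>T. p i) * (unshuffle_sign p T S :: 'k::comm_ring_1)"
proof -
  let ?A = "{(s, t). s \<in> S \<and> t \<in> T \<and> t < s}" and ?B = "{(s, t). s \<in> S \<and> t \<in> T \<and> s < t}"
  let ?f = "\<lambda>(s, t). parity_sign (p s) (p t) :: 'k"
  have fin: "finite ?A" "finite ?B"
    by (rule finite_subset[of _ "S \<times> T"]; use assms in auto)+
  have swap: "unshuffle_sign p T S = prod ?f ?B"
    unfolding unshuffle_sign_def
    by (rule prod.reindex_bij_witness[of _ prod.swap prod.swap]) (auto simp: parity_sign_def)
  have "parity_sign (\<Sum>i\<in>S. p i) (\<Sum>i\<in>T. p i) = (\<Prod>s\<in>S. \<Prod>t\<in>T. parity_sign (p s) (p t) :: 'k)"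
    by (simp only: parity_sign_sum_left parity_sign_sum_right[of "p _"])
  also have "\<dots> = prod ?f (S \<times> T)" by (simp add: prod.cartesian_product)
  also have "S \<times> T = ?A \<union> ?B" 
    using assms(3) by (auto simp: disjoint_iff) (metis linorder_neqE_nat)
  also have "prod ?f (?A \<union> ?B) = prod ?f ?A * prod ?f ?B"
    using fin by (intro prod.union_disjoint) auto
  finally have *: "parity_sign (\<Sum>i\<in>S. p i) (\<Sum>i\<in>T. p i) = prod ?f ?A * prod ?f ?B" .
  have "prod ?f ?B * prod ?f ?B = 1"
    unfolding prod.distrib[symmetric] by (rule prod.neutral) (auto simp: parity_sign_def)
  then show ?thesis
    unfolding swap * by (simp add: unshuffle_sign_def mult.assoc)
qed

text \<open>A new largest index costs nothing when it joins the second set, where it stays in last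
  place; when it joins the first set, it moves past all of the second one.\<close>

lemma unshuffle_sign_insert_right:
  assumes "\<And>s. s \<in> S \<Longrightarrow> s < m"
  shows "unshuffle_sign p S (insert m T) = unshuffle_sign p S T"
  unfolding unshuffle_sign_def using assms
  by (intro prod.cong) (auto dest: less_asym)

lemma unshuffle_sign_insert_left:
  assumes "finite S" "finite T" "m \<notin> S" "\<And>t. t \<in> T \<Longrightarrow> t < m"
  shows "unshuffle_sign p (insert m S) T = unshuffle_sign p S T * parity_sign (p m) (\<Sum>t\<in>T. p t)"
proof -
  let ?A = "{(s, t). s \<in> S \<and> t \<in> T \<and> t < s}"
  have "{(s, t). s \<in> insert m S \<and> t \<in> T \<and> t < s} = ?A \<union> Pair m ` T"
    using assms(4) by auto
  moreover have "finite ?A"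
    by (rule finite_subset[of _ "S \<times> T"]) (use assms in auto)
  moreover have "?A \<inter> Pair m ` T = {}" using assms(3) by auto
  ultimately show ?thesis
    unfolding unshuffle_sign_def parity_sign_sum_right
    using assms(2) by (simp add: prod.union_disjoint prod.reindex inj_on_def)
qed

section \<open>Iterated commutators\<close>

context lie_superalgebra
begin

abbreviation "iter \<equiv> iterated_bracket bracket"

lemma iter_snoc: "iter x (as @ [a]) = bracket (iter x as) a"
  and iter_Nil: "iter x [] = x"
  and iter_Cons: "iter x (a # as) = iter (bracket x a) as"
  and iter_append: "iter x (as @ bs) = iter (iter x as) bs"
  by (simp_all add: iterated_bracket_def)

lemma
  shows bracket_scale_left: "bracket (scale c x) y = scale c (bracket x y)"
    and bracket_zero_left: "bracket 0 y = 0"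
    and bracket_sum_left: "bracket (sum f A) y = (\<Sum>i\<in>A. bracket (f i) y)"
    and bracket_scale_right: "bracket y (scale c x) = scale c (bracket y x)"
proof -
  interpret l: module_hom scale scale "\<lambda>x. bracket x y"
    using linear_bracket_left by (simp add: module_hom_eq_linear)
  interpret r: module_hom scale scale "\<lambda>x. bracket y x"
    using linear_bracket_right by (simp add: module_hom_eq_linear)
  show "bracket (scale c x) y = scale c (bracket x y)" by (rule l.scale)
  show "bracket 0 y = 0" by (rule l.zero)
  show "bracket (sum f A) y = (\<Sum>i\<in>A. bracket (f i) y)" by (rule l.sum)
  show "bracket y (scale c x) = scale c (bracket y x)" by (rule r.scale)
qed

lemma iter_scale: "iter (scale c x) as = scale c (iter x as)"
  by (induction as rule: rev_induct) (simp_all add: iter_snoc iter_Nil bracket_scale_left)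

lemma iter_zero: "iter 0 as = 0"
  by (induction as rule: rev_induct) (simp_all add: iter_snoc iter_Nil bracket_zero_left)

text \<open>Sums of parities are kept as sums in what follows: the rewriting of addition on \<open>bit\<close> to
  exclusive disjunction is switched off, since the sign rules are stated for addition.\<close>

lemma iter_grade:
  assumes "x \<in> grade q" "\<And>i. i \<in> set is \<Longrightarrow> a i \<in> grade (p i)"
  shows "iter x (map a is) \<in> grade (q + sum_list (map p is))"
  using assms(2)
proof (induction "is" rule: rev_induct)
  case Nil
  then show ?case using assms(1) by (simp add: iter_Nil del: add_bit_eq_xor)
next
  case (snoc i "is")
  then show ?case
    using bracket_grade[of "iter x (map a is)" "q + sum_list (map p is)" "a i" "p i"]
    by (simp add: iter_snoc add.assoc del: add_bit_eq_xor)
qed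

lemma iter_grade_sorted_list_of_set:
  assumes "x \<in> grade q" "finite S" "\<And>i. i \<in> S \<Longrightarrow> a i \<in> grade (p i)"
  shows "iter x (map a (sorted_list_of_set S)) \<in> grade (q + (\<Sum>i\<in>S. p i))"
proof -
  have "sum_list (map p (sorted_list_of_set S)) = (\<Sum>i\<in>S. p i)"
    using assms(2) by (simp add: sum_list_distinct_conv_sum_set)
  then show ?thesis
    using iter_grade[OF assms(1), of "sorted_list_of_set S" a p] assms(2,3) by simp
qed

text \<open>The Jacobi identity rewritten for commutators from the right, which are the ones that
  iterated brackets are made of.\<close>

lemma bracket_right_leibniz:
  assumes "x \<in> grade i" "y \<in> grade j" "z \<in> grade l"
  shows "bracket (bracket x y) z =
    bracket x (bracket y z) + scale (parity_sign j l) (bracket (bracket x z) y)"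
proof -
  have "bracket y (bracket x z) = - scale (parity_sign j (i + l)) (bracket (bracket x z) y)"
    using assms by (intro super_antisym bracket_grade)
  moreover have "parity_sign i j * parity_sign j (i + l) = (parity_sign j l :: 'k)"
    using bit_cases[of i] bit_cases[of j] bit_cases[of l] by (auto simp: parity_sign_def)
  ultimately show ?thesis
    using super_jacobi[OF assms] by simp
qed

text \<open>An argument \<open>u\<close> that commutes with all later ones can be moved to the last place: the term
  \<open>[x, [u, a\<^sub>i]]\<close> in the Leibniz rule drops out, so that passing \<open>a\<^sub>i\<close> only costs a sign.\<close>

lemma iter_Cons_commute:
  assumes "x \<in> grade q" "u \<in> grade j"
    and "\<And>i. i \<in> set is \<Longrightarrow> a i \<in> grade (p i)"
    and "\<And>i. i \<in> set is \<Longrightarrow> bracket u (a i) = 0"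
  shows "iter x (u # map a is) =
    scale (parity_sign j (sum_list (map p is))) (bracket (iter x (map a is)) u)"
  using assms(3,4)
proof (induction "is" rule: rev_induct)
  case Nil
  then show ?case by (simp add: iter_Cons iter_Nil parity_sign_def)
next
  case (snoc i "is")
  let ?X = "iter x (map a is)"
  have "iter x (u # map a (is @ [i])) = bracket (iter x (u # map a is)) (a i)"
    using iter_snoc[of x "u # map a is"] by simp
  also have "\<dots> = scale (parity_sign j (sum_list (map p is))) (bracket (bracket ?X u) (a i))"
    using snoc by (simp add: bracket_scale_left)
  also have "bracket (bracket ?X u) (a i) =
      bracket ?X (bracket u (a i)) + scale (parity_sign j (p i)) (bracket (bracket ?X (a i)) u)"
    using snoc.prems by (intro bracket_right_leibniz[OF iter_grade[OF assms(1)] assms(2)]) auto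
  also have "bracket u (a i) = 0" using snoc.prems by simp
  also have "bracket ?X 0 = 0" using bracket_scale_right[of ?X 0 0] by simp
  finally show ?case
    by (simp add: iter_snoc parity_sign_add_right del: add_bit_eq_xor)
qed

text \<open>The iterated Leibniz rule: every \<open>a\<^sub>i\<close> acts on exactly one of the factors \<open>x\<close> and \<open>y\<close>, and
  \<open>S\<close> collects those that act on \<open>x\<close>.  These have to pass \<open>y\<close>, whence the factor
  \<open>parity_sign j (\<Sum>i\<in>S. p i)\<close>, and the earlier \<open>a\<^sub>i\<close> with \<open>i \<notin> S\<close>, whence the shuffle sign.\<close>

lemma iter_bracket_expand:
  assumes x: "x \<in> grade q" and y: "y \<in> grade j"
    and a: "\<And>i. i \<in> {1..n} \<Longrightarrow> a i \<in> grade (p i)"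
  shows "iter (bracket x y) (map a [1..<n + 1]) =
    (\<Sum>S\<in>Pow {1..n}. scale (unshuffle_sign p S ({1..n} - S) * parity_sign j (\<Sum>i\<in>S. p i))
      (bracket (iter x (map a (sorted_list_of_set S)))
               (iter y (map a (sorted_list_of_set ({1..n} - S))))))"
  using a
proof (induction n)
  case 0
  show ?case by (simp add: iter_Nil unshuffle_sign_def parity_sign_def)
next
  case (Suc n)
  let ?m = "Suc n"
  let ?X = "\<lambda>S. iter x (map a (sorted_list_of_set S))"
  let ?Y = "\<lambda>S. iter y (map a (sorted_list_of_set S))"
  let ?t = "\<lambda>N S. scale (unshuffle_sign p S (N - S) * parity_sign j (\<Sum>i\<in>S. p i))
      (bracket (?X S) (?Y (N - S)))"
  have sl: "sorted_list_of_set (insert ?m S) = sorted_list_of_set S @ [?m]" if "S \<subseteq> {1..n}" for S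
  proof -
    have "finite S" using that finite_subset by blast
    moreover have "sorted_wrt (<) (sorted_list_of_set S @ [?m])"
      using that \<open>finite S\<close> by (auto simp: sorted_wrt_append)
    ultimately show ?thesis
      using sorted_list_of_set.idem_if_sorted_distinct[of "sorted_list_of_set S @ [?m]"]
      by (simp add: strict_sorted_iff)
  qed
  \<comment> \<open>The last commutator acts on the second factor, leaving \<open>S\<close> unchanged, or on the first
    one, which adds \<open>?m\<close> to \<open>S\<close>.\<close>
  have step: "bracket (?t {1..n} S) (a ?m) = ?t {1..?m} S + ?t {1..?m} (insert ?m S)"
    if S: "S \<in> Pow {1..n}" for S
  proof -
    let ?T = "{1..n} - S"
    have fin: "finite S" using S finite_subset by blast
    have T1: "{1..?m} - S = insert ?m ?T" and T2: "{1..?m} - insert ?m S = ?T"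
      and T: "?T \<subseteq> {1..n}" and mS: "?m \<notin> S"
      using S by auto
    have gX: "?X S \<in> grade (q + (\<Sum>i\<in>S. p i))"
      using S by (intro iter_grade_sorted_list_of_set[OF x fin] Suc.prems) auto
    have gY: "?Y ?T \<in> grade (j + (\<Sum>i\<in>?T. p i))"
      by (intro iter_grade_sorted_list_of_set[OF y] Suc.prems) auto
    have e1: "unshuffle_sign p S (insert ?m ?T) = unshuffle_sign p S ?T"
      using S by (intro unshuffle_sign_insert_right) auto
    have e2: "unshuffle_sign p (insert ?m S) ?T =
        unshuffle_sign p S ?T * parity_sign (p ?m) (\<Sum>i\<in>?T. p i)"
      using fin mS by (intro unshuffle_sign_insert_left) auto
    have "bracket (bracket (?X S) (?Y ?T)) (a ?m) = bracket (?X S) (bracket (?Y ?T) (a ?m)) +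
        scale (parity_sign (j + (\<Sum>i\<in>?T. p i)) (p ?m)) (bracket (bracket (?X S) (a ?m)) (?Y ?T))"
      using Suc.prems by (intro bracket_right_leibniz[OF gX gY]) auto
    moreover have "?X (insert ?m S) = bracket (?X S) (a ?m)"
      and "?Y (insert ?m ?T) = bracket (?Y ?T) (a ?m)"
      using sl[OF T] sl[of S] S by (simp_all only: Pow_iff map_append list.map iter_snoc)
    ultimately show ?thesis
      unfolding T1 T2 e1 e2 using fin mS
      by (simp add: bracket_scale_left scale_right_distrib parity_sign_add_left
          parity_sign_add_right parity_sign_commute[of "p ?m"] mult_ac del: add_bit_eq_xor)
  qed
  have dist: "Pow {1..n} \<inter> insert ?m ` Pow {1..n} = {}" by auto
  have inj: "inj_on (insert ?m) (Pow {1..n})"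
    by (rule inj_onI) (metis PowD atLeastAtMost_iff insert_ident not_less_eq_eq order_refl subsetD)
  have "iter (bracket x y) (map a [1..<?m + 1]) =
      bracket (iter (bracket x y) (map a [1..<n + 1])) (a ?m)"
    using iter_snoc[of "bracket x y" "map a [1..<n + 1]" "a ?m"] by simp
  also have "\<dots> = (\<Sum>S\<in>Pow {1..n}. bracket (?t {1..n} S) (a ?m))"
    using Suc.IH Suc.prems by (simp add: bracket_sum_left)
  also have "\<dots> = (\<Sum>S\<in>Pow {1..n}. ?t {1..?m} S + ?t {1..?m} (insert ?m S))"
    by (rule sum.cong[OF refl step])
  also have "\<dots> = sum (?t {1..?m}) (Pow {1..n}) + sum (?t {1..?m}) (insert ?m ` Pow {1..n})"
    by (simp only: sum.distrib sum.reindex[OF inj] comp_def)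
  also have "\<dots> = sum (?t {1..?m}) (Pow {1..n} \<union> insert ?m ` Pow {1..n})"
    using dist by (intro sum.union_disjoint[symmetric]) auto
  also have "Pow {1..n} \<union> insert ?m ` Pow {1..n} = Pow {1..?m}"
    by (simp add: atLeastAtMostSuc_conv Pow_insert)
  finally show ?case .
qed

end

section \<open>The Jacobiator of the derived brackets\<close>

text \<open>The setting of Voronov's higher derived brackets.  When \<open>P\<close> is a projection, \<open>P_bracket\<close>
  together with the commutativity of the image says that the kernel is a subalgebra.\<close>

locale derived_bracket_setting = lie_superalgebra scale grade bracket
  for scale :: "'k::field_char_0 \<Rightarrow> 'v::ab_group_add \<Rightarrow> 'v" and grade bracket +
  fixes P :: "'v \<Rightarrow> 'v"
  assumes linear_P: "Vector_Spaces.linear scale scale P"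
    and P_grade: "x \<in> grade i \<Longrightarrow> P x \<in> grade i"
    and range_abelian: "bracket (P x) (P y) = 0"
    and P_bracket: "P (bracket x y) = P (bracket (P x) y) + P (bracket x (P y))"
begin

interpretation P: module_hom scale scale P
  using linear_P by (simp add: module_hom_eq_linear)

text \<open>Both sides are sums over splittings \<open>{1..n} = S \<union> T\<close>.  Expanding \<open>P\<close> of the iterated
  commutator of \<open>[D, D]\<close> gives two terms per splitting, with \<open>P\<close> on either factor; each of the
  two resulting sums is the Jacobiator, and the factor \<open>1 / 2\<close> compensates for this.\<close>

lemma jacobiator_eq_derived_bracket_square:
  assumes D: "D \<in> grade 1" and a: "\<And>i. i \<in> {1..n} \<Longrightarrow> a i \<in> range P \<inter> grade (p i)"
  shows "(\<Sum>(k, l)\<in>{(k, l). k + l = n}. \<Sum>\<sigma>\<in>kl_shuffles k l.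
      scale (koszul_sign p n \<sigma>)
        (derived_bracket bracket P D
          (derived_bracket bracket P D (map (\<lambda>i. a (\<sigma> i)) [1..<k + 1]) #
            map (\<lambda>i. a (\<sigma> i)) [k + 1..<k + l + 1]))) =
    derived_bracket bracket P (scale (1 / 2) (bracket D D)) (map a [1..<n + 1])"
    (is "?J = _")
proof -
  let ?N = "{1..n}"
  let ?D = "\<lambda>S. iter D (map a (sorted_list_of_set S))"
  let ?e = "\<lambda>S. unshuffle_sign p S (?N - S) :: 'k"
  let ?p = "\<lambda>S. \<Sum>i\<in>S. p i"
  let ?B = "\<lambda>S. P (bracket (?D (?N - S)) (P (?D S)))"
  let ?j = "\<lambda>S. scale (?e S * parity_sign (1 + ?p S) (?p (?N - S))) (?B S)"
  have gD: "?D S \<in> grade (1 + ?p S)" if "S \<subseteq> ?N" for S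
  proof -
    have "finite S" using that finite_subset by blast
    then show ?thesis
      using a that by (intro iter_grade_sorted_list_of_set[OF D]) auto
  qed
  have "?J = (\<Sum>S\<in>Pow ?N. scale (?e S)
      (P (iter D (P (?D S) # map a (sorted_list_of_set (?N - S))))))"
    using sum_kl_shuffles_eq_sum_Pow[where n = n and p = p and f = "\<lambda>c us vs. scale c
      (P (iter D (P (iter D (map a us)) # map a vs)))"]
    by (simp add: derived_bracket_def comp_def del: upt_Suc)
  also have "\<dots> = (\<Sum>S\<in>Pow ?N. ?j S)"
  proof (rule sum.cong[OF refl])
    fix S assume "S \<in> Pow ?N"
    then have S: "S \<subseteq> ?N" by simp
    have "bracket (P (?D S)) (a i) = 0" if "i \<in> ?N" for i
      using a[OF that] range_abelian by auto
    then have "iter D (P (?D S) # map a (sorted_list_of_set (?N - S))) =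
        scale (parity_sign (1 + ?p S) (?p (?N - S))) (bracket (?D (?N - S)) (P (?D S)))"
      using iter_Cons_commute[OF D P_grade[OF gD[OF S]], of "sorted_list_of_set (?N - S)" a p] a
      by (simp add: sum_list_distinct_conv_sum_set del: add_bit_eq_xor)
    then show "scale (?e S) (P (iter D (P (?D S) # map a (sorted_list_of_set (?N - S))))) = ?j S"
      by (simp add: P.scale)
  qed
  finally have J: "?J = (\<Sum>S\<in>Pow ?N. ?j S)" .
  have "P (iter (bracket D D) (map a [1..<n + 1])) =
      (\<Sum>S\<in>Pow ?N. scale (?e S * parity_sign 1 (?p S)) (P (bracket (?D S) (?D (?N - S)))))"
    using iter_bracket_expand[OF D D, of n a p] a by (simp add: P.sum P.scale del: upt_Suc)
  also have "\<dots> = (\<Sum>S\<in>Pow ?N. ?j S + scale (?e S * parity_sign 1 (?p S)) (?B (?N - S)))"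
  proof (rule sum.cong[OF refl])
    fix S assume "S \<in> Pow ?N"
    then have S: "S \<subseteq> ?N" "?N - (?N - S) = S" by auto
    have "bracket (P (?D S)) (?D (?N - S)) =
        - scale (parity_sign (1 + ?p S) (1 + ?p (?N - S))) (bracket (?D (?N - S)) (P (?D S)))"
      using S by (intro super_antisym P_grade gD) auto
    moreover have "parity_sign 1 x * parity_sign (1 + x) (1 + y) = - (parity_sign (1 + x) y :: 'k)"
      for x y using bit_cases[of x] bit_cases[of y] by (auto simp: parity_sign_def)
    ultimately have "scale (?e S * parity_sign 1 (?p S)) (P (bracket (P (?D S)) (?D (?N - S)))) = ?j S"
      by (simp add: P.scale P.neg mult.assoc del: add_bit_eq_xor)
    then show "scale (?e S * parity_sign 1 (?p S)) (P (bracket (?D S) (?D (?N - S)))) =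
        ?j S + scale (?e S * parity_sign 1 (?p S)) (?B (?N - S))"
      by (simp only: P_bracket[of "?D S" "?D (?N - S)"] scale_right_distrib S(2))
  qed
  also have "\<dots> = ?J + (\<Sum>S\<in>Pow ?N. scale (?e S * parity_sign 1 (?p S)) (?B (?N - S)))"
    unfolding J by (rule sum.distrib)
  \<comment> \<open>Exchanging \<open>S\<close> and its complement turns the terms with \<open>P\<close> on the second factor into those
    of the Jacobiator; \<open>unshuffle_sign_swap\<close> accounts for the sign.\<close>
  also have "(\<Sum>S\<in>Pow ?N. scale (?e S * parity_sign 1 (?p S)) (?B (?N - S))) = (\<Sum>S\<in>Pow ?N. ?j S)"
  proof (rule sum.reindex_bij_witness[of _ "\<lambda>S. ?N - S" "\<lambda>S. ?N - S"], goal_cases)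
    case (5 S)
    then have S: "?N - (?N - S) = S" and fin: "finite S" using finite_subset by auto
    have "?e S = parity_sign (?p S) (?p (?N - S)) * unshuffle_sign p (?N - S) S"
      using fin by (intro unshuffle_sign_swap) auto
    moreover have "parity_sign x y * c * parity_sign 1 x = c * (parity_sign (1 + y) x :: 'k)" for x y c
      using bit_cases[of x] bit_cases[of y] by (auto simp: parity_sign_def)
    ultimately have "?e S * parity_sign 1 (?p S) =
        unshuffle_sign p (?N - S) S * parity_sign (1 + ?p (?N - S)) (?p S)"
      by (simp only:)
    then show ?case
      by (simp only: S)
  qed auto
  also have "\<dots> = ?J" by (rule J[symmetric])
  finally have double: "P (iter (bracket D D) (map a [1..<n + 1])) = ?J + ?J" .
  have half: "scale (1 / 2) (v + v) = v" for v
    using scale_left_distrib[of "1 / 2" "1 / 2" v] by (simp add: scale_right_distrib)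
  show ?thesis
    unfolding derived_bracket_def[of bracket P "scale (1 / 2) (bracket D D)"] iter_scale P.scale
      double half ..
qed

lemma generalized_jacobi_derived_bracket:
  assumes D: "D \<in> grade 1" and ord: "ord_le bracket (range P) (scale (1 / 2) (bracket D D)) r"
    and "r < n"
  shows "generalized_jacobi scale grade (range P) (derived_bracket bracket P D) n"
  unfolding generalized_jacobi_def
proof (intro allI impI)
  fix a p assume a: "\<forall>i\<in>{1..n}. a i \<in> range P \<inter> grade (p i)"
  let ?as = "map a [1..<n + 1]" and ?E = "scale (1 / 2) (bracket D D)"
  \<comment> \<open>The order bound speaks of \<open>r + 1\<close> arguments; already the first \<open>r + 1\<close> of the \<open>n\<close>
    arguments annihilate \<open>?E\<close>.\<close>
  have "set (take (r + 1) ?as) \<subseteq> set ?as" by (rule set_take_subset)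
  also have "set ?as \<subseteq> range P" using a by auto
  finally have "iter ?E (take (r + 1) ?as) = 0"
    using ord \<open>r < n\<close> unfolding ord_le_def by (metis Suc_eq_plus1 Suc_leI add_diff_cancel_right'
        length_map length_take length_upt min.absorb2)
  then have "iter ?E ?as = 0"
    using iter_append[of ?E "take (r + 1) ?as" "drop (r + 1) ?as"] iter_zero
    unfolding append_take_drop_id by simp
  then show "(\<Sum>(k, l)\<in>{(k, l). k + l = n}. \<Sum>\<sigma>\<in>kl_shuffles k l.
      scale (koszul_sign p n \<sigma>)
        (derived_bracket bracket P D
          (derived_bracket bracket P D (map (\<lambda>i. a (\<sigma> i)) [1..<k + 1]) #
            map (\<lambda>i. a (\<sigma> i)) [k + 1..<k + l + 1]))) = 0"
    using jacobiator_eq_derived_bracket_square[OF D, of n a p] a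
    by (simp add: derived_bracket_def del: upt_Suc)
qed

end

theorem corollary2:
  fixes scale :: "'k::field_char_0 \<Rightarrow> 'v::ab_group_add \<Rightarrow> 'v"
    and grade :: "bit \<Rightarrow> 'v set"
    and bracket :: "'v \<Rightarrow> 'v \<Rightarrow> 'v"
    and P :: "'v \<Rightarrow> 'v"
    and V :: "'v set"
    and \<Delta> :: 'v
    and r :: nat
  assumes "lie_superalgebra scale grade bracket"
    and "Vector_Spaces.linear scale scale P"
    and "\<And>i x. x \<in> grade i \<Longrightarrow> P x \<in> grade i"
    and "\<And>x. P (P x) = P x"
    and "\<And>a b. bracket (P a) (P b) = 0"
    and "\<And>a b. P (bracket a b) = P (bracket (P a) b) + P (bracket a (P b))"
    and "V = range P"
    and "\<Delta> \<in> grade 1"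
    and "ord_le bracket V (scale (1 / 2) (bracket \<Delta> \<Delta>)) r"
  shows "\<forall>n>r. generalized_jacobi scale grade V (derived_bracket bracket P \<Delta>) n"
proof -
  interpret derived_bracket_setting scale grade bracket P
    by (intro derived_bracket_setting.intro derived_bracket_setting_axioms.intro) (fact assms)+
  show ?thesis
    using generalized_jacobi_derived_bracket[OF assms(8)] assms(9) unfolding assms(7) by blast
qed

end
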